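(* For each $\epsilon>0$ there exist a minimal disk $\Sigma$, embedded in the half cylinder $\{(x,y,z)\in\mathbb{R}^3: x^2+y^2\le 1,\ z\ge 0\}$, and a constant $C>0$ such that $$\frac1C\,h^{-2(1+\epsilon)}\ \le\ \sup_{\Sigma\cap\{z\ge h\}}|A_\Sigma|^2\ \le\ C\,h^{-2(1+\epsilon)}$$ for all sufficiently small $h>0$.
   Context: $|A_\Sigma|$ denotes the length of the second fundamental form of the surface $\Sigma\subset\mathbb{R}^3$. A minimal surface is one with vanishing mean curvature. *)

theory Defs
  imports "HOL-Analysis.Analysis"
begin

fun Ck_on :: "nat \<Rightarrow> ('a::real_normed_vector \<Rightarrow> 'b::real_normed_vector) \<Rightarrow> 'a set \<Rightarrow> bool" where
  "Ck_on 0 f S \<longleftrightarrow> continuous_on S f"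
| "Ck_on (Suc k) f S \<longleftrightarrow>
     (\<forall>x\<in>S. f differentiable (at x)) \<and>
     (\<forall>v. Ck_on k (\<lambda>x. frechet_derivative f (at x) v) S)"

text \<open>Derivatives are taken at \<open>at x\<close>, so this is only meant for open \<open>S\<close>.\<close>

definition smooth_on :: "('a::real_normed_vector \<Rightarrow> 'b::real_normed_vector) \<Rightarrow> 'a set \<Rightarrow> bool" where
  "smooth_on f S \<longleftrightarrow> (\<forall>k. Ck_on k f S)"

definition unit_disk :: "(real^2) set" where
  "unit_disk = ball 0 1"

definition pderiv_at :: "2 \<Rightarrow> (real^2 \<Rightarrow> real^3) \<Rightarrow> real^2 \<Rightarrow> real^3" where
  "pderiv_at i F u = frechet_derivative F (at u) (axis i 1)"

definition unit_normal :: "(real^2 \<Rightarrow> real^3) \<Rightarrow> real^2 \<Rightarrow> real^3" where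
  "unit_normal F u =
     (let n = cross3 (pderiv_at 1 F u) (pderiv_at 2 F u) in n /\<^sub>R norm n)"

definition first_ff :: "(real^2 \<Rightarrow> real^3) \<Rightarrow> real^2 \<Rightarrow> real^2^2" where
  "first_ff F u = (\<chi> i j. pderiv_at i F u \<bullet> pderiv_at j F u)"

definition second_ff :: "(real^2 \<Rightarrow> real^3) \<Rightarrow> real^2 \<Rightarrow> real^2^2" where
  "second_ff F u = (\<chi> i j. pderiv_at i (pderiv_at j F) u \<bullet> unit_normal F u)"

definition mean_curvature :: "(real^2 \<Rightarrow> real^3) \<Rightarrow> real^2 \<Rightarrow> real" where
  "mean_curvature F u = trace (matrix_inv (first_ff F u) ** second_ff F u)"

text \<open>
  The squared length of the second fundamental form \<open>A\<close> in the metric \<open>g\<close> induced on the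
  surface, \<open>|A|\<^sup>2 = g\<^sup>i\<^sup>k g\<^sup>j\<^sup>l A\<^sub>i\<^sub>j A\<^sub>k\<^sub>l\<close>. It does not depend on the parametrization, so for an
  injective immersion \<open>F\<close> it is a function of the point \<open>F u\<close> of the surface.
\<close>

definition second_ff_norm_sq :: "(real^2 \<Rightarrow> real^3) \<Rightarrow> real^2 \<Rightarrow> real" where
  "second_ff_norm_sq F u =
     (let g' = matrix_inv (first_ff F u); A = second_ff F u
      in \<Sum>i\<in>UNIV. \<Sum>j\<in>UNIV. \<Sum>k\<in>UNIV. \<Sum>l\<in>UNIV.
           g' $ i $ k * g' $ j $ l * A $ i $ j * A $ k $ l)"

text \<open>
  \<open>F\<close> parametrizes an embedded disk \<open>\<Sigma> = F ` unit_disk\<close>: a smooth immersion that is a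
  homeomorphism onto its image. The disk is open, and \<open>\<Sigma>\<close> need not be closed in the
  ambient space.
\<close>

definition embedded_disk :: "(real^2 \<Rightarrow> real^3) \<Rightarrow> bool" where
  "embedded_disk F \<longleftrightarrow>
     smooth_on F unit_disk \<and>
     (\<forall>u\<in>unit_disk. inj (frechet_derivative F (at u))) \<and>
     (\<exists>G. homeomorphism unit_disk (F ` unit_disk) F G)"

definition embedded_minimal_disk :: "(real^2 \<Rightarrow> real^3) \<Rightarrow> bool" where
  "embedded_minimal_disk F \<longleftrightarrow>
     embedded_disk F \<and> (\<forall>u\<in>unit_disk. mean_curvature F u = 0)"

definition half_cylinder :: "(real^3) set" where
  "half_cylinder = {p. (p$1)\<^sup>2 + (p$2)\<^sup>2 \<le> 1 \<and> p$3 \<ge> 0}"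

text \<open>
  The supremum of \<open>|A|\<^sup>2\<close> over the part of the surface in \<open>{z \<ge> h}\<close>, taken in the extended
  reals: it is \<open>\<infinity>\<close> if \<open>|A|\<^sup>2\<close> is unbounded there and \<open>-\<infinity>\<close> if that part is empty.
\<close>

definition sup_curvature_above :: "(real^2 \<Rightarrow> real^3) \<Rightarrow> real \<Rightarrow> ereal" where
  "sup_curvature_above F h =
     (SUP u \<in> {u \<in> unit_disk. F u $ 3 \<ge> h}. ereal (second_ff_norm_sq F u))"

end

theory Submission
  imports Defs "HOL-Complex_Analysis.Complex_Analysis"
begin

unbundle no fps_syntax

text \<open>
  Let \<open>h w = w powr - \<epsilon>\<close> on the right half plane. The Weierstrass data with height differential
  \<open>dw\<close> and Gauss map \<open>exp (\<i> h)\<close> give the immersion \<open>(Im P, Im Q, Re)\<close> with \<open>P' = sin h\<close> and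
  \<open>Q' = - cos h\<close>, for which \<open>|A|\<^sup>2 = 2 |h'|\<^sup>2 / cosh\<^sup>4 (Im h)\<close>. Normalizing \<open>P\<close> and \<open>Q\<close> to be real on
  the positive axis, this axis is mapped to the vertical axis, where \<open>Im h = 0\<close> and thus
  \<open>|A|\<^sup>2 = 2 \<epsilon>\<^sup>2 z powr (- 2 (1 + \<epsilon>))\<close>; everywhere else \<open>|A|\<^sup>2\<close> is smaller than this at the same
  height. On the cusp \<open>|y| < x powr (1 + \<epsilon>) / (2 \<epsilon>)\<close> the function \<open>h\<close> varies by at most
  \<open>1/2\<close> along each vertical segment from the axis, so every horizontal slice of the surface is a
  graph over a line and the immersion is an embedding. Finally, a thin half-strip-like region
  (the image of the disk under \<open>2 - c log (1 - z)\<close>) is mapped into the cusp by the power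
  \<open>- 1 / \<epsilon>\<close>, which provides a conformal parametrization over the unit disk.
\<close>

section \<open>Real parts of holomorphic curves\<close>

text \<open>Openness of \<open>S\<close> lets the equality pass to Frechet derivatives at each
  point, which the recursive clause of \<open>Ck_on\<close> refers to.\<close>

lemma Ck_on_cong:
  assumes "open S" "\<And>x. x \<in> S \<Longrightarrow> f x = g x" "Ck_on k f S"
  shows "Ck_on k g S"
  using assms(2,3)
proof (induction k arbitrary: f g)
  case 0
  then show ?case using continuous_on_cong[of S S f g] by simp
next
  case (Suc k)
  have "f differentiable at x \<and> frechet_derivative f (at x) = frechet_derivative g (at x)" if "x \<in> S" for x
    using Suc.prems that frechet_derivative_transform_within_open[OF _ assms(1) that, of f g] by auto
  moreover have "g differentiable at x" if "x \<in> S" for x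
    using Suc.prems that assms(1) unfolding differentiable_def
    by (metis Ck_on.simps(2) differentiable_def has_derivative_transform_within_open)
  ultimately show ?case
    using Suc.prems Suc.IH[of "\<lambda>x. frechet_derivative f (at x) _" "\<lambda>x. frechet_derivative g (at x) _"]
    by auto
qed

definition cplx :: "real^2 \<Rightarrow> complex" where
  "cplx p = Complex (p$1) (p$2)"

lemma cplx_axis [simp]: "cplx (axis 1 1) = 1" "cplx (axis 2 1) = \<i>"
  by (simp_all add: cplx_def axis_def complex_eq_iff)

lemma norm_cplx [simp]: "cmod (cplx p) = norm p"
  by (simp add: cplx_def cmod_def norm_vec_def L2_set_def UNIV_2)

lemma linear_cplx: "linear cplx"
  by (auto intro!: linearI simp: cplx_def complex_eq_iff)

lemma bounded_linear_cplx: "bounded_linear cplx"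
  using linear_cplx linear_conv_bounded_linear by blast

lemma cplx_eq_0_iff [simp]: "cplx p = 0 \<longleftrightarrow> p = 0"
  by (metis norm_cplx norm_eq_zero)

lemma cplx_mem_ball: "cplx p \<in> ball 0 1 \<longleftrightarrow> p \<in> unit_disk"
  by (simp add: unit_disk_def)

text \<open>Minimal surfaces are real parts of holomorphic null curves. Keeping \<open>f\<close> as
  a family of complex functions lets all differentiation take place on the complex side.\<close>

definition re_map :: "('n \<Rightarrow> complex \<Rightarrow> complex) \<Rightarrow> real^2 \<Rightarrow> real^'n" where
  "re_map f p = (\<chi> j. Re (f j (cplx p)))"

lemma has_derivative_vec:
  fixes f :: "'a::real_normed_vector \<Rightarrow> real^'n"
  assumes "\<And>j. ((\<lambda>x. f x $ j) has_derivative (\<lambda>v. f' v $ j)) F"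
  shows "(f has_derivative f') F"
proof -
  have "((\<lambda>x. \<Sum>j\<in>UNIV. (f x $ j) *\<^sub>R (axis j 1 :: real^'n)) has_derivative
         (\<lambda>v. \<Sum>j\<in>UNIV. (f' v $ j) *\<^sub>R axis j 1)) F"
    by (intro derivative_intros assms)
  moreover have "(\<Sum>j\<in>UNIV. (x $ j) *\<^sub>R (axis j 1 :: real^'n)) = x" for x :: "real^'n"
    by (simp add: vec_eq_iff axis_def if_distrib sum.delta cong: if_cong)
  ultimately show ?thesis by simp
qed

lemma has_derivative_re_map:
  assumes "\<And>j. (f j has_field_derivative g j (cplx p)) (at (cplx p))"
  shows "(re_map f has_derivative (\<lambda>v. re_map (\<lambda>j z. g j z * cplx v) p)) (at p)"
proof (rule has_derivative_vec)
  fix j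
  have "((\<lambda>q. f j (cplx q)) has_derivative (\<lambda>v. g j (cplx p) * cplx v)) (at p)"
    using has_derivative_compose[OF bounded_linear_imp_has_derivative[OF bounded_linear_cplx]]
      assms[of j] unfolding has_field_derivative_def by blast
  from has_derivative_Re[OF this]
  show "((\<lambda>x. re_map f x $ j) has_derivative (\<lambda>v. re_map (\<lambda>j z. g j z * cplx v) p $ j)) (at p)"
    by (simp add: re_map_def)
qed

lemma open_unit_disk: "open unit_disk"
  by (simp add: unit_disk_def)

text \<open>Maps of the form \<open>re_map f\<close> with holomorphic \<open>f\<close> are closed
  under directional derivatives: direction \<open>v\<close> replaces each component by its complex
  derivative times the constant \<open>cplx v\<close>. Hence the induction on \<open>k\<close> with
  \<open>f\<close> arbitrary.\<close>

lemma smooth_on_re_map: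
  assumes "\<And>j. f j holomorphic_on ball 0 1"
  shows "smooth_on (re_map f) unit_disk"
proof -
  have "Ck_on k (re_map f) unit_disk" for k
    using assms
  proof (induction k arbitrary: f)
    case (0 f)
    have "continuous_on unit_disk (\<lambda>p. f j (cplx p))" for j
      by (rule continuous_on_compose2[OF holomorphic_on_imp_continuous_on[OF 0[of j]]
              linear_continuous_on[OF bounded_linear_cplx]])
        (auto simp: unit_disk_def)
    then show ?case by (simp add: re_map_def continuous_intros)
  next
    case (Suc k f)
    have D: "(re_map f has_derivative (\<lambda>v. re_map (\<lambda>j z. deriv (f j) z * cplx v) p)) (at p)"
      if "p \<in> unit_disk" for p
      by (rule has_derivative_re_map) (metis Suc.prems cplx_mem_ball holomorphic_derivI open_ball that)
    have "Ck_on k (\<lambda>p. frechet_derivative (re_map f) (at p) v) unit_disk" for v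
    proof (rule Ck_on_cong[OF open_unit_disk])
      show "Ck_on k (re_map (\<lambda>j z. deriv (f j) z * cplx v)) unit_disk"
        by (intro Suc.IH holomorphic_intros Suc.prems open_ball)
    qed (use frechet_derivative_at[OF D] in metis)
    then show ?case using D by (auto simp: differentiable_def)
  qed
  then show ?thesis by (simp add: smooth_on_def)
qed

lemma pderiv_at_re_map:
  assumes "\<And>j z. z \<in> ball 0 1 \<Longrightarrow> (f j has_field_derivative g j z) (at z)" "u \<in> unit_disk"
  shows "pderiv_at i (re_map f) u = re_map (\<lambda>j z. g j z * cplx (axis i 1)) u"
  unfolding pderiv_at_def
  using frechet_derivative_at[OF has_derivative_re_map[of f g u]] assms cplx_mem_ball by metis

lemma pderiv_at_pderiv_at_re_map:
  assumes "\<And>j z. z \<in> ball 0 1 \<Longrightarrow> (f j has_field_derivative g j z) (at z)"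
    and "\<And>j z. z \<in> ball 0 1 \<Longrightarrow> (g j has_field_derivative k j z) (at z)" and u: "u \<in> unit_disk"
  shows "pderiv_at i (pderiv_at l (re_map f)) u
           = re_map (\<lambda>j z. k j z * cplx (axis l 1) * cplx (axis i 1)) u"
proof -
  define G where "G = re_map (\<lambda>j z. g j z * cplx (axis l 1))"
  have D: "((\<lambda>z. g j z * cplx (axis l 1)) has_field_derivative k j z * cplx (axis l 1)) (at z)"
    if "z \<in> ball 0 1" for j z
    using assms(2)[OF that] by (rule DERIV_cmult_right)
  have "(G has_derivative (\<lambda>v. re_map (\<lambda>j z. (k j z * cplx (axis l 1)) * cplx v) u)) (at u)"
    unfolding G_def by (rule has_derivative_re_map, rule D) (use u cplx_mem_ball in blast)
  then have "G differentiable at u"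
    unfolding differentiable_def by blast
  \<comment> \<open>The first partial derivative is known to equal \<open>G\<close> only on the
    disk; as the disk is open, this still determines its derivative at \<open>u\<close>.\<close>
  from frechet_derivative_transform_within_open[OF this open_unit_disk u, of "pderiv_at l (re_map f)"]
  have "pderiv_at i (pderiv_at l (re_map f)) u = pderiv_at i G u"
    using pderiv_at_re_map[OF assms(1)] by (simp add: pderiv_at_def[of i] G_def)
  then show ?thesis
    unfolding G_def using pderiv_at_re_map[where g = "\<lambda>j z. k j z * cplx (axis l 1)", OF D u] by simp
qed

lemma matrix_inv_mat:
  fixes c :: real
  assumes "c \<noteq> 0"
  shows "matrix_inv (mat c :: real^'n^'n) = mat (1/c)"
proof -
  have "mat c ** mat d = (mat (c * d) :: real^'n^'n)" for c d :: real
  proof -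
    have "(\<Sum>k\<in>UNIV. (if i = k then c else 0) * (if k = j then d else 0)) = (if i = j then c * d else 0)"
      for i j :: 'n
    proof -
      have "(\<Sum>k\<in>UNIV. (if i = k then c else 0) * (if k = j then d else 0))
          = (\<Sum>k\<in>UNIV. if k = i then c * (if i = j then d else 0) else 0)"
        by (rule sum.cong) auto
      then show ?thesis by (simp add: sum.delta)
    qed
    then show ?thesis by (simp add: matrix_matrix_mult_def mat_def vec_eq_iff)
  qed
  then have *: "(mat c :: real^'n^'n) ** mat (1/c) = mat 1" "(mat (1/c) :: real^'n^'n) ** mat c = mat 1"
    using assms by simp_all
  \<comment> \<open>\<open>matrix_inv\<close> is a choice operator, so the existence of some
    two-sided inverse makes it an inverse; uniqueness then identifies it.\<close>
  then have "mat c ** matrix_inv (mat c :: real^'n^'n) = mat 1"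
    unfolding matrix_inv_def by (metis (mono_tags, lifting) someI_ex)
  then show ?thesis
    using * by (metis matrix_mul_assoc matrix_mul_lid matrix_mul_rid)
qed

section \<open>The Weierstrass representation\<close>

lemma Re_sin_sinh: "Re (sin z) = sin (Re z) * cosh (Im z)"
  and Im_sin_sinh: "Im (sin z) = cos (Re z) * sinh (Im z)"
  and Re_cos_sinh: "Re (cos z) = cos (Re z) * cosh (Im z)"
  and Im_cos_sinh: "Im (cos z) = - sin (Re z) * sinh (Im z)"
  by (simp_all add: Re_sin Im_sin Re_cos Im_cos cosh_def sinh_def field_simps)

text \<open>The curve with derivative \<open>Z'\<close> times (-i sin H, i cos H, 1) is null because
  1 - sin^2 - cos^2 = 0. \<open>P\<close> and \<open>Q\<close> are parameters of the locale, so that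
  primitives found on the half plane can be pulled back to the disk.\<close>

locale weierstrass =
  fixes Z H P Q Z' H' :: "complex \<Rightarrow> complex"
  assumes Z: "\<And>z. z \<in> ball 0 1 \<Longrightarrow> (Z has_field_derivative Z' z) (at z)"
    and H: "\<And>z. z \<in> ball 0 1 \<Longrightarrow> (H has_field_derivative H' z) (at z)"
    and P: "\<And>z. z \<in> ball 0 1 \<Longrightarrow> (P has_field_derivative sin (H z) * Z' z) (at z)"
    and Q: "\<And>z. z \<in> ball 0 1 \<Longrightarrow> (Q has_field_derivative - cos (H z) * Z' z) (at z)"
    and Z'_nz: "\<And>z. z \<in> ball 0 1 \<Longrightarrow> Z' z \<noteq> 0"
begin

unbundle no fps_syntax

definition curve :: "3 \<Rightarrow> complex \<Rightarrow> complex" where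
  "curve j z = (if j = 1 then - \<i> * P z else if j = 2 then - \<i> * Q z else Z z)"

definition curve' :: "3 \<Rightarrow> complex \<Rightarrow> complex" where
  "curve' j z = (if j = 1 then - \<i> * sin (H z) else if j = 2 then \<i> * cos (H z) else 1) * Z' z"

definition curve'' :: "3 \<Rightarrow> complex \<Rightarrow> complex" where
  "curve'' j z =
     (if j = 1 then - \<i> * sin (H z) else if j = 2 then \<i> * cos (H z) else 1) * deriv Z' z +
     (if j = 1 then - \<i> * cos (H z) else if j = 2 then - \<i> * sin (H z) else 0) * H' z * Z' z"

definition surf :: "real^2 \<Rightarrow> real^3" where
  "surf = re_map curve"

lemma surf_eq: "surf p = vector [Im (P (cplx p)), Im (Q (cplx p)), Re (Z (cplx p))]"
  by (simp add: surf_def re_map_def curve_def vec_eq_iff forall_3)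

lemma has_derivative_curve:
  assumes "z \<in> ball 0 1"
  shows "(curve j has_field_derivative curve' j z) (at z)"
proof -
  consider "j = 1" | "j = 2" | "j = 3" using exhaust_3 by blast
  then show ?thesis
    by cases (auto simp: curve_def[abs_def] curve'_def intro!: derivative_eq_intros P Q Z assms)
qed

lemma Z'_holomorphic: "Z' holomorphic_on ball 0 1"
proof -
  have "Z holomorphic_on ball 0 1"
    using Z by (meson field_differentiable_at_within field_differentiable_def holomorphic_on_def)
  then have "deriv Z holomorphic_on ball 0 1" by (rule holomorphic_deriv) simp
  then show ?thesis
    by (rule holomorphic_transform) (use Z DERIV_imp_deriv in blast)
qed

lemma has_derivative_curve':
  assumes "z \<in> ball 0 1"
  shows "(curve' j has_field_derivative curve'' j z) (at z)"
proof -
  have Z': "(Z' has_field_derivative deriv Z' z) (at z)"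
    using Z'_holomorphic assms holomorphic_derivI open_ball by blast
  consider "j = 1" | "j = 2" | "j = 3" using exhaust_3 by blast
  then show ?thesis
  proof cases
    case 1
    then show ?thesis using assms
      by (auto simp: curve'_def[abs_def] curve''_def algebra_simps intro!: derivative_eq_intros Z' H)
  next
    case 2
    then show ?thesis using assms
      by (auto simp: curve'_def[abs_def] curve''_def algebra_simps intro!: derivative_eq_intros Z' H)
  next
    case 3
    then show ?thesis using Z' by (simp add: curve'_def[abs_def] curve''_def)
  qed
qed

lemma smooth_surf: "smooth_on surf unit_disk"
  unfolding surf_def
  by (rule smooth_on_re_map)
    (meson has_derivative_curve field_differentiable_at_within field_differentiable_def holomorphic_on_def)

text \<open>For a kernel vector put w = \<open>Z'\<close> times the vector. The height coordinate
  forces Re w = 0, and the other two then force Im w times sin (Re H) cosh (Im H) and Im w times cos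
  (Re H) cosh (Im H) to vanish. Sine and cosine have no common zero and cosh is positive.\<close>

lemma immersion_surf:
  assumes "u \<in> unit_disk"
  shows "inj (frechet_derivative surf (at u))"
proof -
  let ?L = "\<lambda>v. re_map (\<lambda>j z. curve' j z * cplx v) u"
  have D: "(surf has_derivative ?L) (at u)"
    unfolding surf_def
    by (rule has_derivative_re_map) (use assms has_derivative_curve cplx_mem_ball in blast)
  have "v = 0" if "?L v = 0" for v
  proof -
    let ?z = "cplx u"
    define w where "w = Z' ?z * cplx v"
    have "Re (curve' j ?z * cplx v) = 0" for j
      using that by (simp add: re_map_def vec_eq_iff)
    from this[of 1] this[of 2] this[of 3]
    have w: "Im (sin (H ?z) * w) = 0" "Im (cos (H ?z) * w) = 0" "Re w = 0"
      by (simp_all add: curve'_def w_def algebra_simps)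
    then have "Re (sin (H ?z)) * Im w = 0" "Re (cos (H ?z)) * Im w = 0" by simp_all
    moreover have "Re (sin (H ?z)) \<noteq> 0 \<or> Re (cos (H ?z)) \<noteq> 0"
      unfolding Re_sin_sinh Re_cos_sinh
      using sin_cos_squared_add[of "Re (H ?z)"] cosh_real_pos[of "Im (H ?z)"]
      by (metis add.right_neutral mult_eq_0_iff order_less_irrefl power_zero_numeral zero_neq_one)
    ultimately have "w = 0" using w by (auto simp: complex_eq_iff)
    then show ?thesis
      using Z'_nz assms by (simp add: w_def flip: cplx_mem_ball)
  qed
  then have "inj ?L"
    using has_derivative_linear[OF D] linear_injective_0 by blast
  then show ?thesis using frechet_derivative_at[OF D] by simp
qed

section \<open>Fundamental forms and curvature in isothermal coordinates\<close>

context
  fixes u assumes u: "u \<in> unit_disk"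
begin

unbundle no fps_syntax

abbreviation (input) "a \<equiv> Z' (cplx u)"
abbreviation (input) "th \<equiv> Re (H (cplx u))"
abbreviation (input) "v \<equiv> Im (H (cplx u))"

lemma pderiv_surf:
  "pderiv_at 1 surf u = vector [sin th * cosh v * Im a + cos th * sinh v * Re a,
      sin th * sinh v * Re a - cos th * cosh v * Im a, Re a]"
  "pderiv_at 2 surf u = vector [sin th * cosh v * Re a - cos th * sinh v * Im a,
      - (cos th * cosh v * Re a) - sin th * sinh v * Im a, - Im a]"
proof -
  have pd: "pderiv_at i surf u = re_map (\<lambda>j z. curve' j z * cplx (axis i 1)) u" for i
    unfolding surf_def by (rule pderiv_at_re_map[OF has_derivative_curve u])
  show "pderiv_at 1 surf u = vector [sin th * cosh v * Im a + cos th * sinh v * Re a,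
      sin th * sinh v * Re a - cos th * cosh v * Im a, Re a]"
    "pderiv_at 2 surf u = vector [sin th * cosh v * Re a - cos th * sinh v * Im a,
      - (cos th * cosh v * Re a) - sin th * sinh v * Im a, - Im a]"
    unfolding pd
    by (simp_all add: re_map_def curve'_def vec_eq_iff
        forall_3 Re_sin_sinh Im_sin_sinh Re_cos_sinh Im_cos_sinh algebra_simps)
qed

text \<open>Nullity of the curve makes the parameters isothermal, with factor |Z'|^2 (|sin H|^2 +
  |cos H|^2 + 1) / 2, and |sin H|^2 + |cos H|^2 = cosh^2 + sinh^2 at Im H.\<close>

lemma first_ff_surf: "first_ff surf u = mat ((cmod a)\<^sup>2 * (cosh v)\<^sup>2)"
proof -
  have c: "(cosh v)\<^sup>2 = 1 + (sinh v)\<^sup>2" "(cos th)\<^sup>2 = 1 - (sin th)\<^sup>2"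
    by (simp_all add: cosh_square_eq cos_squared_eq)
  show ?thesis
    unfolding first_ff_def mat_def cmod_power2
    by (simp add: vec_eq_iff forall_2 pderiv_surf inner_vec_def sum_3; 
        intro conjI; use c in algebra)
qed

text \<open>Stereographic projection from the north pole sends this normal to exp (i th) / (cosh v +
  sinh v) = exp (i H), the prescribed Gauss map.\<close>

lemma unit_normal_surf:
  "unit_normal surf u = vector [cos th / cosh v, sin th / cosh v, - sinh v / cosh v]"
proof -
  have c: "(cosh v)\<^sup>2 = 1 + (sinh v)\<^sup>2" "(cos th)\<^sup>2 = 1 - (sin th)\<^sup>2"
    by (simp_all add: cosh_square_eq cos_squared_eq)
  define n :: "real^3" where "n = vector [cos th, sin th, - sinh v]"
  have "cross3 (pderiv_at 1 surf u) (pderiv_at 2 surf u) = ((cmod a)\<^sup>2 * cosh v) *\<^sub>R n"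
  proof -
    have 1: "(sin th * sinh v * Re a - cos th * cosh v * Im a) * - Im a
        - Re a * (- (cos th * cosh v * Re a) - sin th * sinh v * Im a)
        = ((Re a)\<^sup>2 + (Im a)\<^sup>2) * cosh v * cos th"
      by algebra
    have 2: "Re a * (sin th * cosh v * Re a - cos th * sinh v * Im a)
        - (sin th * cosh v * Im a + cos th * sinh v * Re a) * - Im a
        = ((Re a)\<^sup>2 + (Im a)\<^sup>2) * cosh v * sin th"
      by algebra
    have 3: "(sin th * cosh v * Im a + cos th * sinh v * Re a) *
          (- (cos th * cosh v * Re a) - sin th * sinh v * Im a)
        - (sin th * sinh v * Re a - cos th * cosh v * Im a) *
          (sin th * cosh v * Re a - cos th * sinh v * Im a)
        = ((Re a)\<^sup>2 + (Im a)\<^sup>2) * cosh v * - sinh v"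
      using c(2) by algebra
    show ?thesis
      unfolding cross3_def pderiv_surf n_def cmod_power2 vector_3 1 2 3
      by (simp add: vec_eq_iff forall_3)
  qed
  moreover have "n \<bullet> n = (cosh v)\<^sup>2"
    by (simp add: n_def inner_vec_def sum_3; use c in algebra)
  then have "norm n = cosh v"
    by (simp add: norm_eq_sqrt_inner)
  moreover have "a \<noteq> 0" using Z'_nz u cplx_mem_ball by blast
  ultimately have "unit_normal surf u = n /\<^sub>R cosh v"
    by (simp add: unit_normal_def Let_def field_simps)
  then show ?thesis by (simp add: n_def vec_eq_iff forall_3 divide_inverse mult.commute)
qed

text \<open>The part of the second derivative along the first one is tangential, and the rest has
  normal component \<open>-\<i> H' Z'\<close>, because \<open>cos (H - Re H) = cosh (Im H)\<close>.\<close>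

lemma second_ff_surf:
  "second_ff surf u $ i $ l
     = Re (- \<i> * H' (cplx u) * a * cplx (axis l 1) * cplx (axis i 1))"
proof -
  define w where "w = cplx (axis l 1) * cplx (axis i 1)"
  define m where "m = H' (cplx u) * a * w"
  define d where "d = deriv Z' (cplx u) * w"
  have c: "(cosh v)\<^sup>2 = 1 + (sinh v)\<^sup>2" "(cos th)\<^sup>2 = 1 - (sin th)\<^sup>2"
    by (simp_all add: cosh_square_eq cos_squared_eq)
  let ?H = "H (cplx u)"
  have X: "curve'' 1 (cplx u) * w = - \<i> * (sin ?H * d + cos ?H * m)"
    "curve'' 2 (cplx u) * w = \<i> * (cos ?H * d - sin ?H * m)"
    "curve'' 3 (cplx u) * w = d"
    by (simp_all add: curve''_def d_def m_def algebra_simps)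
  have "pderiv_at i (pderiv_at l surf) u = re_map (\<lambda>j z. curve'' j z * w) u"
    unfolding surf_def w_def mult.assoc[symmetric]
    by (rule pderiv_at_pderiv_at_re_map[OF has_derivative_curve has_derivative_curve' u])
  also have "\<dots> = vector [Im (sin ?H * d + cos ?H * m), - Im (cos ?H * d - sin ?H * m), Re d]"
    unfolding re_map_def using X by (simp add: vec_eq_iff forall_3 del: times_complex.sel)
  finally have pd: "pderiv_at i (pderiv_at l surf) u = \<dots>" .
  have "second_ff surf u $ i $ l =
    (Im (sin ?H * d + cos ?H * m) * cos th - Im (cos ?H * d - sin ?H * m) * sin th - Re d * sinh v) / cosh v"
    unfolding second_ff_def unit_normal_surf
    by (simp add: pd inner_vec_def sum_3 diff_divide_distrib add_divide_distrib
        del: times_complex.sel plus_complex.sel minus_complex.sel)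
  also have "Im (sin ?H * d + cos ?H * m) * cos th - Im (cos ?H * d - sin ?H * m) * sin th - Re d * sinh v
      = cosh v * Im m"
    by (simp add: Re_sin_sinh Im_sin_sinh Re_cos_sinh Im_cos_sinh; use c in algebra)
  finally show ?thesis by (simp add: m_def w_def mult.assoc)
qed

lemma metric_factor_pos: "(cmod a)\<^sup>2 * (cosh v)\<^sup>2 > 0"
  using Z'_nz[of "cplx u"] u cplx_mem_ball by (simp add: zero_less_mult_iff)

text \<open>The metric is conformal, so only the trace of the second form matters. The two
  coordinate directions 1 and i enter squared and hence contribute opposite values.\<close>

lemma mean_curvature_surf: "mean_curvature surf u = 0"
proof -
  have "matrix_inv (first_ff surf u) = mat (1 / ((cmod a)\<^sup>2 * (cosh v)\<^sup>2))"
    unfolding first_ff_surf using metric_factor_pos[THEN less_imp_neq] by (intro matrix_inv_mat) simp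
  then show ?thesis
    by (simp add: mean_curvature_def trace_def matrix_matrix_mult_def sum_2 mat_def second_ff_surf
        flip: add_divide_distrib)
qed

text \<open>Up to sign the entries of the second form are Re m and Im m, each occurring twice, for m
  = H' Z'. The quotient H' / Z' that remains after dividing by the squared metric factor is the
  derivative of H with respect to Z.\<close>

lemma second_ff_norm_sq_surf:
  "second_ff_norm_sq surf u = 2 * (cmod (H' (cplx u) / a))\<^sup>2 / (cosh v) ^ 4"
proof -
  have I: "matrix_inv (first_ff surf u) = mat (1 / ((cmod a)\<^sup>2 * (cosh v)\<^sup>2))"
    unfolding first_ff_surf using metric_factor_pos[THEN less_imp_neq] by (intro matrix_inv_mat) simp
  define m where "m = H' (cplx u) * a"
  define q where "q = 1 / ((cmod a)\<^sup>2 * (cosh v)\<^sup>2)"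
  have "second_ff_norm_sq surf u = q\<^sup>2 * 2 * ((Re m)\<^sup>2 + (Im m)\<^sup>2)"
    unfolding second_ff_norm_sq_def I q_def[symmetric]
    by (simp add: Let_def sum_2 mat_def second_ff_surf mult.assoc flip: m_def)
      (simp add: power2_eq_square algebra_simps)
  also have "\<dots> = q\<^sup>2 * 2 * (cmod m)\<^sup>2" by (simp add: cmod_power2)
  also have "\<dots> = 2 * (cmod (H' (cplx u) / a))\<^sup>2 / (cosh v) ^ 4"
    using metric_factor_pos
    by (simp add: q_def m_def norm_mult norm_divide field_simps power2_eq_square power4_eq_xxxx)
  finally show ?thesis .
qed

end

end

section \<open>A cuspidal region\<close>

text \<open>Mean value inequality on a convex half plane, where |z| is at least x and the derivative
  of the power is therefore largest at x.\<close>

lemma cmod_powr_neg_diff_le: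
  assumes "s > 0" "x > 0" "Re a \<ge> x" "Re b \<ge> x"
  shows "cmod (a powr - of_real s - b powr - of_real s) \<le> s * x powr (- s - 1) * cmod (a - b)"
proof (rule field_differentiable_bound[OF convex_halfspace_Re_ge])
  fix z assume z: "z \<in> {z. Re z \<ge> x}"
  then have "z \<notin> \<real>\<^sub>\<le>\<^sub>0" using assms by (auto simp: complex_nonpos_Reals_iff)
  then show "((\<lambda>z. z powr - of_real s) has_field_derivative
        - of_real s * z powr (- of_real s - 1)) (at z within {z. Re z \<ge> x})"
    by (rule has_field_derivative_at_within[OF has_field_derivative_powr])
  have "x \<le> cmod z" using z complex_Re_le_cmod[of z] by simp
  then have "cmod z powr (- s - 1) \<le> x powr (- s - 1)"
    using assms by (intro powr_mono2') auto
  moreover have "cmod (z powr (- of_real s - 1)) = cmod z powr (- s - 1)"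
    by (subst norm_powr_real_powr') auto
  ultimately show "cmod (- of_real s * z powr (- of_real s - 1)) \<le> s * x powr (- s - 1)"
    using assms by (simp add: norm_mult)
qed (use assms in auto)

text \<open>\<open>w\<close> is compared with its real part, whose logarithm is real; the derivative
  1/z is bounded by 1 / Re w between them.\<close>

lemma abs_Im_Ln_le:
  assumes "Re w > 0"
  shows "\<bar>Im (Ln w)\<bar> \<le> \<bar>Im w\<bar> / Re w"
proof -
  have "cmod (Ln w - Ln (of_real (Re w))) \<le> inverse (Re w) * cmod (w - of_real (Re w))"
  proof (rule field_differentiable_bound[OF convex_halfspace_Re_ge])
    fix z assume z: "z \<in> {z. Re z \<ge> Re w}"
    then have "z \<notin> \<real>\<^sub>\<le>\<^sub>0" using assms by (auto simp: complex_nonpos_Reals_iff)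
    then show "(Ln has_field_derivative inverse z) (at z within {z. Re z \<ge> Re w})"
      by (rule has_field_derivative_at_within[OF has_field_derivative_Ln])
    show "cmod (inverse z) \<le> inverse (Re w)"
      unfolding norm_inverse
      using z assms complex_Re_le_cmod[of z] by (intro le_imp_inverse_le) auto
  qed auto
  moreover have "w - of_real (Re w) = \<i> * of_real (Im w)" by (simp add: complex_eq_iff)
  moreover have "Im (Ln (of_real (Re w))) = 0" using assms by (simp add: Ln_of_real)
  ultimately show ?thesis
    using abs_Im_le_cmod[of "Ln w - Ln (of_real (Re w))"] by (simp add: norm_mult divide_inverse mult.commute)
qed

lemma norm_sin_le_cosh: "cmod (sin z) \<le> cosh (Im z)"
proof (rule power2_le_imp_le)
  have "(cmod (sin z))\<^sup>2 = (sin (Re z))\<^sup>2 * (cosh (Im z))\<^sup>2 + (cos (Re z))\<^sup>2 * (sinh (Im z))\<^sup>2"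
    by (simp add: cmod_power2 Re_sin_sinh Im_sin_sinh power_mult_distrib)
  also have "\<dots> \<le> (sin (Re z))\<^sup>2 * (cosh (Im z))\<^sup>2 + (cos (Re z))\<^sup>2 * (cosh (Im z))\<^sup>2"
    by (intro add_left_mono mult_left_mono) (auto simp: cosh_square_eq)
  finally show "(cmod (sin z))\<^sup>2 \<le> (cosh (Im z))\<^sup>2"
    by (simp flip: distrib_right)
qed simp

lemma norm_cos_le_cosh: "cmod (cos z) \<le> cosh (Im z)"
  using norm_sin_le_cosh[of "of_real (pi/2) - z"] by (simp add: sin_diff flip: cos_of_real sin_of_real)

text \<open>The last condition keeps the power -e within 1/2 of its value on the axis, so slices
  hardly turn. The bound 1/4 on the imaginary part keeps the slices short enough to fit into the
  cylinder.\<close>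

definition cusp :: "real \<Rightarrow> complex set" where
  "cusp e = {w. 0 < Re w \<and> \<bar>Im w\<bar> < 1/4 \<and> 2 * e * \<bar>Im w\<bar> < Re w powr (1 + e)}"

lemma open_cusp: "open (cusp e)"
proof -
  have "cusp e = {w. 0 < Re w} \<inter> {w. \<bar>Im w\<bar> < 1/4} \<inter>
      {w \<in> {w. 0 < Re w}. 0 < Re w powr (1 + e) - 2 * e * \<bar>Im w\<bar>}"
    by (auto simp: cusp_def)
  moreover have "open {w. 0 < Re w}" "open {w. \<bar>Im w\<bar> < 1/4}"
    by (intro open_Collect_less continuous_intros)+
  moreover have "open {w \<in> {w. 0 < Re w}. 0 < Re w powr (1 + e) - 2 * e * \<bar>Im w\<bar>}"
  proof -
    have "continuous_on {w. 0 < Re w} (\<lambda>w. Re w powr (1 + e) - 2 * e * \<bar>Im w\<bar>)"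
      by (intro continuous_intros) auto
    from continuous_open_preimage[OF this \<open>open {w. 0 < Re w}\<close> open_greaterThan[of 0]]
    show ?thesis by (simp add: vimage_def Int_def conj_commute)
  qed
  ultimately show ?thesis by auto
qed

lemma cusp_vertical:
  assumes "w \<in> cusp e" "e > 0" "\<bar>t\<bar> \<le> \<bar>Im w\<bar>"
  shows "Complex (Re w) t \<in> cusp e"
proof -
  have "2 * e * \<bar>t\<bar> \<le> 2 * e * \<bar>Im w\<bar>" using assms by (intro mult_left_mono) auto
  also have "2 * e * \<bar>Im w\<bar> < Re w powr (1 + e)" using assms by (simp add: cusp_def)
  finally have "2 * e * \<bar>t\<bar> < Re w powr (1 + e)" .
  then show ?thesis using assms by (auto simp: cusp_def)
qed

lemma cusp_powr_close:
  assumes "w \<in> cusp e" "e > 0"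
  shows "cmod (w powr - of_real e - of_real (Re w powr - e)) \<le> 1/2"
proof -
  let ?x = "Re w"
  have x: "?x > 0" using assms by (simp add: cusp_def)
  have "cmod (w powr - of_real e - of_real ?x powr - of_real e)
      \<le> e * ?x powr (- e - 1) * cmod (w - of_real ?x)"
    using cmod_powr_neg_diff_le[of e ?x w "of_real ?x"] assms x by simp
  also have "w - of_real ?x = \<i> * of_real (Im w)" by (simp add: complex_eq_iff)
  also have "e * ?x powr (- e - 1) * cmod (\<i> * of_real (Im w)) = ?x powr (- e - 1) * (e * \<bar>Im w\<bar>)"
    by (simp add: norm_mult)
  also have "\<dots> \<le> ?x powr (- e - 1) * (?x powr (1 + e) / 2)"
    using assms by (intro mult_left_mono) (auto simp: cusp_def)
  also have "\<dots> = 1/2"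
    using x by (simp flip: powr_add)
  also have "of_real ?x powr - of_real e = (of_real (?x powr - e) :: complex)"
    using x by (simp add: powr_of_real flip: of_real_minus)
  finally show ?thesis .
qed

lemma abs_Im_cusp_powr_le:
  assumes "w \<in> cusp e" "e > 0"
  shows "\<bar>Im (w powr - of_real e)\<bar> \<le> 1/2"
  using cusp_powr_close[OF assms] abs_Im_le_cmod[of "w powr - of_real e - of_real (Re w powr - e)"]
  by simp

lemma cosh_half_le: "\<bar>x\<bar> \<le> 1/2 \<Longrightarrow> cosh (x::real) \<le> 2"
proof -
  assume x: "\<bar>x\<bar> \<le> 1/2"
  have "exp \<bar>x\<bar> \<le> exp 1" using x by (subst exp_le_cancel_iff) simp
  then have "exp \<bar>x\<bar> \<le> 3" by (rule order_trans) (rule exp_le)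
  moreover have "exp (- \<bar>x\<bar>) \<le> 1" by simp
  ultimately have "exp \<bar>x\<bar> + exp (- \<bar>x\<bar>) \<le> 3 + 1" by (rule add_mono)
  then have "cosh \<bar>x\<bar> \<le> 2" unfolding cosh_def by simp
  then show ?thesis by simp
qed

lemma Re_cos_ge_half:
  assumes "cmod z \<le> 1/2"
  shows "Re (cos z) \<ge> 1/2"
proof -
  have "\<bar>Re z\<bar> \<le> 1/2" using assms abs_Re_le_cmod[of z] by linarith
  then have "cos (1/2) \<le> cos \<bar>Re z\<bar>" using pi_gt3 by (subst cos_mono_le_eq) auto
  moreover have "cos (pi/3) \<le> cos (1/2::real)" using pi_gt3 by (subst cos_mono_le_eq) auto
  ultimately have "1/2 \<le> cos (Re z)" by (simp add: cos_60)
  then show ?thesis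
    using mult_mono[of "1/2" "cos (Re z)" 1 "cosh (Im z)"] cosh_real_ge_1[of "Im z"]
    by (simp add: Re_cos_sinh)
qed

lemma has_real_derivative_Im_line:
  assumes "(g has_field_derivative D) (at (a + of_real t * d))"
  shows "((\<lambda>t. Im (g (a + of_real t * d))) has_real_derivative Im (D * d)) (at t)"
proof -
  have "((\<lambda>t. a + of_real t * d) has_vector_derivative d) (at t)"
    by (auto intro!: derivative_eq_intros)
  from field_vector_diff_chain_at[OF this assms]
  have "((\<lambda>t. g (a + of_real t * d)) has_vector_derivative (d * D)) (at t)"
    by (simp add: o_def)
  then have "((\<lambda>t. g (a + of_real t * d)) has_derivative (\<lambda>x. x *\<^sub>R (d * D))) (at t)"
    by (simp add: has_vector_derivative_def)
  from has_derivative_Im[OF this] show ?thesis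
    by (simp add: has_field_derivative_def mult.commute[of d] mult_commute_abs)
qed

text \<open>Along the positive axis Im g has derivative Im f = 0, hence is constant, and subtracting
  g 1 makes it vanish. This places the image of the axis on the vertical axis.\<close>

lemma primitive_real_on_positive_reals:
  assumes "f holomorphic_on {w. 0 < Re w}" "\<And>x. x > 0 \<Longrightarrow> Im (f (of_real x)) = 0"
  obtains g where "\<And>w. 0 < Re w \<Longrightarrow> (g has_field_derivative f w) (at w)"
    "\<And>x. x > 0 \<Longrightarrow> Im (g (of_real x)) = 0"
proof -
  have op: "open {w. 0 < Re w}" by (rule open_halfspace_Re_gt)
  obtain g where g: "\<And>w. w \<in> {w. 0 < Re w} \<Longrightarrow> (g has_field_derivative f w) (at w within {w. 0 < Re w})"
    using holomorphic_convex_primitive'[OF convex_halfspace_Re_gt op assms(1)] by blast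
  then have g: "(g has_field_derivative f w) (at w)" if "0 < Re w" for w
    using that at_within_open[OF _ op] by fastforce
  have "Im (g (of_real x)) = Im (g (of_real 1))" if "x > 0" for x
  proof (rule DERIV_isconst3[where f = "\<lambda>t. Im (g (of_real t))"])
    show "0 < x + 2" "x \<in> {0<..<x+2}" "1 \<in> {0<..<x+2}" using that by auto
    fix t assume t: "t \<in> {0<..<x+2}"
    then have "(g has_field_derivative f (of_real t)) (at (0 + of_real t * 1))"
      using g[of "of_real t"] by simp
    from has_real_derivative_Im_line[OF this]
    show "((\<lambda>t. Im (g (of_real t))) has_real_derivative 0) (at t)"
      using assms(2)[of t] t by simp
  qed
  moreover have "((\<lambda>w. g w - g 1) has_field_derivative f w) (at w)" if "0 < Re w" for w
    using g[OF that] by (auto intro!: derivative_eq_intros)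
  ultimately show ?thesis
    by (intro that[of "\<lambda>w. g w - g 1"]) auto
qed

section \<open>The surface over the cusp: size, injectivity and continuous inverse\<close>

locale spiral =
  fixes e :: real and P Q :: "complex \<Rightarrow> complex"
  assumes e: "e > 0"
    and P: "\<And>w. 0 < Re w \<Longrightarrow> (P has_field_derivative sin (w powr - of_real e)) (at w)"
    and Q: "\<And>w. 0 < Re w \<Longrightarrow> (Q has_field_derivative - cos (w powr - of_real e)) (at w)"
    and P_real: "\<And>x. x > 0 \<Longrightarrow> Im (P (of_real x)) = 0"
    and Q_real: "\<And>x. x > 0 \<Longrightarrow> Im (Q (of_real x)) = 0"
begin

text \<open>The vertical segment from the axis to \<open>w\<close> stays in the cusp and has length
  below 1/4; the integrand is at most 2 there and Im g vanishes at the foot. Two such coordinates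
  give x^2 + y^2 at most 1/2.\<close>

lemma abs_Im_primitive_le:
  assumes "w \<in> cusp e" "\<And>w. 0 < Re w \<Longrightarrow> (g has_field_derivative f w) (at w)"
    "\<And>w. w \<in> cusp e \<Longrightarrow> cmod (f w) \<le> 2" "\<And>x. x > 0 \<Longrightarrow> Im (g (of_real x)) = 0"
  shows "\<bar>Im (g w)\<bar> \<le> 1/2"
proof -
  have w: "0 < Re w" "\<bar>Im w\<bar> < 1/4" using assms(1) by (auto simp: cusp_def)
  have seg: "z \<in> cusp e" if z: "z \<in> closed_segment (of_real (Re w)) w" for z
  proof -
    obtain t where t: "0 \<le> t" "t \<le> 1" "z = (1 - t) *\<^sub>R of_real (Re w) + t *\<^sub>R w"
      using z in_segment(1)[of z "of_real (Re w)" w] by metis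
    then have "z = Complex (Re w) (t * Im w)" by (simp add: complex_eq_iff algebra_simps)
    moreover have "\<bar>t * Im w\<bar> \<le> \<bar>Im w\<bar>" using t by (simp add: abs_mult mult_left_le_one_le)
    ultimately show ?thesis using cusp_vertical[OF assms(1) e] by simp
  qed
  have "cmod (g w - g (of_real (Re w))) \<le> 2 * cmod (w - of_real (Re w))"
  proof (rule field_differentiable_bound[OF convex_closed_segment[of "of_real (Re w)" w]])
    fix z assume "z \<in> closed_segment (of_real (Re w)) w"
    then have "z \<in> cusp e" by (rule seg)
    then show "cmod (f z) \<le> 2"
      "(g has_field_derivative f z) (at z within closed_segment (of_real (Re w)) w)"
      using assms(2)[of z] assms(3) by (auto simp: cusp_def intro: has_field_derivative_at_within)
  qed auto
  moreover have "w - of_real (Re w) = \<i> * of_real (Im w)" by (simp add: complex_eq_iff)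
  ultimately show ?thesis
    using abs_Im_le_cmod[of "g w - g (of_real (Re w))"] assms(4)[of "Re w"] w by (simp add: norm_mult)
qed

lemma abs_Im_P_le: "w \<in> cusp e \<Longrightarrow> \<bar>Im (P w)\<bar> \<le> 1/2"
  by (rule abs_Im_primitive_le[OF _ P _ P_real])
    (auto intro: order_trans[OF norm_sin_le_cosh] cosh_half_le abs_Im_cusp_powr_le e)

lemma abs_Im_Q_le: "w \<in> cusp e \<Longrightarrow> \<bar>Im (Q w)\<bar> \<le> 1/2"
  by (rule abs_Im_primitive_le[OF _ Q _ Q_real])
    (auto intro: order_trans[OF norm_cos_le_cosh] cosh_half_le abs_Im_cusp_powr_le e)

text \<open>A horizontal slice is a graph over its tangent line at the axis: the slice turns by at most
  \<open>1/2\<close> away from that line.\<close>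

lemma slice_expanding:
  assumes "w1 \<in> cusp e" "w2 \<in> cusp e" "Re w1 = Re w2"
  shows "\<bar>Im w1 - Im w2\<bar> \<le> 2 * (\<bar>Im (P w1) - Im (P w2)\<bar> + \<bar>Im (Q w1) - Im (Q w2)\<bar>)"
  using assms
proof (induction "Im w1" "Im w2" arbitrary: w1 w2 rule: linorder_wlog)
  case sym
  then show ?case by (metis abs_minus_commute)
next
  case (le w1 w2)
  define x a where "x = Re w1" and "a = x powr - e"
  have x: "x > 0" using le by (simp add: x_def cusp_def)
  \<comment> \<open>Im g is the coordinate of a slice point along (sin a, - cos a), the tangent of
    the slice at the axis. By the addition formula its derivative in the slice is Re (cos (H -
    a)).\<close>
  define g where "g w = of_real (sin a) * P w - of_real (cos a) * Q w" for w
  have w: "w = of_real x + of_real (Im w) * \<i>" if "Re w = x" for w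
    using that by (simp add: complex_eq_iff)
  show ?case
  proof (cases "Im w1 = Im w2")
    case False
    then have lt: "Im w1 < Im w2" using le by simp
    define D where "D t = Re (cos ((of_real x + of_real t * \<i>) powr - of_real e - of_real a))" for t
    have "((\<lambda>t. Im (g (of_real x + of_real t * \<i>))) has_real_derivative D t) (at t)" for t
    proof -
      let ?w = "of_real x + of_real t * \<i>"
      let ?H = "?w powr - of_real e"
      have "(g has_field_derivative of_real (sin a) * sin ?H - of_real (cos a) * (- cos ?H)) (at ?w)"
        unfolding g_def by (intro derivative_intros DERIV_cmult P Q) (use x in auto)
      moreover have "of_real (sin a) * sin ?H - of_real (cos a) * (- cos ?H) = cos (?H - of_real a)"
        by (simp add: cos_diff flip: sin_of_real cos_of_real)
      ultimately have "(g has_field_derivative cos (?H - of_real a)) (at ?w)" by simp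
      from has_real_derivative_Im_line[OF this] show ?thesis by (simp add: D_def)
    qed
    from MVT2[OF lt this] obtain t where t: "Im w1 < t" "t < Im w2"
      "Im (g (of_real x + of_real (Im w2) * \<i>)) - Im (g (of_real x + of_real (Im w1) * \<i>))
        = (Im w2 - Im w1) * D t" by blast
    then have gd: "Im (g w2) - Im (g w1) = (Im w2 - Im w1) * D t"
      using w[of w1] w[of w2] le by (simp add: x_def)
    have "\<bar>t\<bar> \<le> \<bar>Im w1\<bar> \<or> \<bar>t\<bar> \<le> \<bar>Im w2\<bar>" using t by linarith
    then have c: "Complex x t \<in> cusp e"
      using cusp_vertical[of w1 e t] cusp_vertical[of w2 e t] e le by (auto simp: x_def)
    have "Complex x t = of_real x + of_real t * \<i>" by (simp add: complex_eq_iff)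
    then have "D t \<ge> 1/2"
      unfolding D_def using cusp_powr_close[OF c e] by (intro Re_cos_ge_half) (simp add: a_def)
    then have "(Im w2 - Im w1) * (1/2) \<le> Im (g w2) - Im (g w1)"
      unfolding gd using lt by (intro mult_left_mono) auto
    also have "\<dots> = sin a * (Im (P w2) - Im (P w1)) - cos a * (Im (Q w2) - Im (Q w1))"
      by (simp add: g_def algebra_simps)
    also have "\<dots> \<le> \<bar>sin a * (Im (P w2) - Im (P w1))\<bar> + \<bar>cos a * (Im (Q w2) - Im (Q w1))\<bar>"
      by linarith
    also have "\<dots> \<le> \<bar>Im (P w1) - Im (P w2)\<bar> + \<bar>Im (Q w1) - Im (Q w2)\<bar>"
    proof -
      have "\<bar>s * (p - q)\<bar> \<le> \<bar>q - p\<bar>" if "\<bar>s\<bar> \<le> 1" for s p q :: real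
        using mult_left_le_one_le[of "\<bar>p - q\<bar>" "\<bar>s\<bar>"] that by (simp add: abs_mult abs_minus_commute)
      then show ?thesis by (intro add_mono) auto
    qed
    finally show ?thesis using lt by simp
  qed simp
qed

definition emb :: "complex \<Rightarrow> real^3" where
  "emb w = vector [Im (P w), Im (Q w), Re w]"

lemma emb_inj: "inj_on emb (cusp e)"
proof (rule inj_onI)
  fix w1 w2 assume w: "w1 \<in> cusp e" "w2 \<in> cusp e" "emb w1 = emb w2"
  then have "Im (P w1) = Im (P w2)" "Im (Q w1) = Im (Q w2)" "Re w1 = Re w2"
    by (simp_all add: emb_def vec_eq_iff forall_3)
  with slice_expanding[OF w(1,2)] show "w1 = w2" by (simp add: complex_eq_iff)
qed

lemma continuous_on_emb: "continuous_on {w. 0 < Re w} emb"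
proof -
  have "continuous_on {w. 0 < Re w} P" "continuous_on {w. 0 < Re w} Q"
    using P Q by (auto intro!: continuous_at_imp_continuous_on DERIV_isCont)
  then have "continuous_on {w. 0 < Re w} (\<lambda>w. emb w $ j)" for j
    using exhaust_3[of j] by (elim disjE; simp add: emb_def continuous_on_Im continuous_on_Re)
  then have "continuous_on {w. 0 < Re w} (\<lambda>w. \<chi> j. emb w $ j)"
    by (rule continuous_on_vec_lambda)
  then show ?thesis by (simp add: vec_lambda_eta)
qed

text \<open>The height already controls the real part. For the imaginary part, \<open>w'\<close> is
  compared with the point \<open>s (Re w')\<close> of the same slice that has the imaginary part of
  \<open>w\<close>: its image is close to \<open>emb w\<close> by continuity, and
  \<open>slice_expanding\<close> applies within the slice.\<close>

lemma continuous_on_emb_inverse: "continuous_on (emb ` cusp e) (inv_into (cusp e) emb)"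
proof -
  have "\<exists>d>0. \<forall>w'\<in>cusp e. dist (emb w') (emb w) < d \<longrightarrow> dist w' w < r"
    if w: "w \<in> cusp e" and r: "r > 0" for w r
  proof -
    define s where "s x = of_real x + of_real (Im w) * \<i>" for x
    have sw: "s (Re w) = w" by (simp add: s_def complex_eq_iff)
    have "isCont s (Re w)" unfolding s_def by (intro continuous_intros)
    then have st: "(s \<longlongrightarrow> w) (at (Re w))" by (simp add: isCont_def sw)
    have "continuous (at (s (Re w))) emb"
      using continuous_on_emb w continuous_on_eq_continuous_at[OF open_halfspace_Re_gt[of 0]]
      by (auto simp: sw cusp_def)
    with \<open>isCont s (Re w)\<close> have "isCont (\<lambda>x. emb (s x)) (Re w)" by (rule isCont_o2)
    then obtain d1 where d1: "d1 > 0" "\<And>x. dist x (Re w) < d1 \<Longrightarrow> dist (emb (s x)) (emb w) < r/20"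
      using r unfolding continuous_at_eps_delta by (metis divide_pos_pos dist_norm sw zero_less_numeral)
    from topological_tendstoD[OF st open_cusp[of e] w]
    obtain d2 where d2: "d2 > 0" "\<And>x. x \<noteq> Re w \<Longrightarrow> dist x (Re w) < d2 \<Longrightarrow> s x \<in> cusp e"
      unfolding eventually_at by auto
    \<comment> \<open>\<open>d2\<close> keeps the comparison point in the cusp. Two errors of r/20
      give r/10 per horizontal coordinate, so \<open>slice_expanding\<close> yields 4r/10, and the
      real part adds at most r/20.\<close>
    define d where "d = min (min d1 d2) (r/20)"
    have d: "d > 0" "d \<le> d1" "d \<le> d2" "d \<le> r/20" using d1 d2 r by (auto simp: d_def)
    have "dist w' w < r" if w': "w' \<in> cusp e" and dd: "dist (emb w') (emb w) < d" for w'
    proof -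
      let ?v = "s (Re w')"
      have comp: "\<bar>a $ j - b $ j\<bar> \<le> dist a b" for a b :: "real^3" and j
        using component_le_norm_cart[of "a - b" j] by (simp add: dist_norm)
      have re: "\<bar>Re w' - Re w\<bar> < d"
        using comp[of "emb w'" 3 "emb w"] dd by (simp add: emb_def)
      then have v: "?v \<in> cusp e" using d2(2)[of "Re w'"] d w sw by (cases "Re w' = Re w") (auto simp: dist_real_def)
      have "dist (emb ?v) (emb w) < r/20" using d1(2)[of "Re w'"] re d by (simp add: dist_real_def)
      then have "dist (emb w') (emb ?v) < r/10"
        using dd d dist_triangle[of "emb w'" "emb ?v" "emb w"] by (simp add: dist_commute)
      then have "\<bar>Im (P w') - Im (P ?v)\<bar> < r/10" "\<bar>Im (Q w') - Im (Q ?v)\<bar> < r/10"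
        using comp[of "emb w'" 1 "emb ?v"] comp[of "emb w'" 2 "emb ?v"] by (simp_all add: emb_def)
      then have "\<bar>Im w' - Im w\<bar> < 4 * (r/10)"
        using slice_expanding[OF w' v] by (simp add: s_def)
      then show ?thesis
        using re d cmod_le[of "w' - w"] by (simp add: dist_norm)
    qed
    then show ?thesis using d by blast
  qed
  then show ?thesis
    unfolding continuous_on_iff using emb_inj by (auto simp: inv_into_f_f)
qed

end

section \<open>Parametrization of the cusp by the unit disk\<close>

text \<open>The power of \<open>W\<close> lies within \<open>b\<close> of the real number R^(-1/e),
  whose power 1 + e is R^(-1/e-1), the same factor that occurs in \<open>b\<close>. So a strip of
  constant width is carried into the cusp.\<close>

lemma powr_inverse_mem_cusp:
  assumes e: "e > 0" and W: "Re W \<ge> 1" "\<bar>Im W\<bar> \<le> e / 8" "\<bar>Im W\<bar> < 2 powr (- 2 - e)"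
  shows "W powr - of_real (1 / e) \<in> cusp e"
    and "(W powr - of_real (1 / e)) powr - of_real e = W"
proof -
  define R t where "R = Re W" and "t = \<bar>Im W\<bar>"
  define w where "w = W powr - of_real (1 / e)"
  define b where "b = R powr (- 1 / e - 1) * t / e"
  have R: "R \<ge> 1" and t: "0 \<le> t" "t / e \<le> 1/8" "t < 2 powr (- 2 - e)"
    using W e by (auto simp: R_def t_def divide_simps)
  have RW: "W - of_real R = \<i> * of_real (Im W)" by (simp add: complex_eq_iff R_def)
  have "cmod (w - of_real R powr - of_real (1 / e)) \<le> (1/e) * R powr (- (1/e) - 1) * cmod (W - of_real R)"
    unfolding w_def by (rule cmod_powr_neg_diff_le) (use e R in \<open>auto simp: R_def\<close>)
  moreover have "of_real R powr - of_real (1 / e) = (of_real (R powr (- 1 / e)) :: complex)"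
    using R by (simp add: powr_of_real flip: of_real_minus of_real_divide)
  ultimately have d: "cmod (w - of_real (R powr (- 1 / e))) \<le> b"
    by (simp add: RW norm_mult b_def t_def)
  have p: "R powr (- 1 / e - 1) \<le> 1" "R powr (- 1 / e - 1) \<le> R powr (- 1 / e)"
  proof -
    have "- 1 / e - 1 \<le> 0" using e by (simp add: field_simps)
    from powr_mono[OF this R] show "R powr (- 1 / e - 1) \<le> 1" using R by simp
    show "R powr (- 1 / e - 1) \<le> R powr (- 1 / e)" using R by (intro powr_mono) auto
  qed
  have b: "b \<le> R powr (- 1 / e - 1) * (1/8)"
    unfolding b_def times_divide_eq_right[symmetric] by (intro mult_left_mono t) simp
  then have b1: "b < 1/4" "b \<le> R powr (- 1 / e) / 2"
    using p powr_ge_zero[of R "- 1 / e"] by linarith+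
  have "\<bar>Re w - R powr (- 1 / e)\<bar> \<le> b" and Im: "\<bar>Im w\<bar> \<le> b"
    using d abs_Re_le_cmod[of "w - of_real (R powr (- 1 / e))"]
      abs_Im_le_cmod[of "w - of_real (R powr (- 1 / e))"] by auto
  then have Re: "R powr (- 1 / e) / 2 \<le> Re w" using b1 by linarith
  have "R powr (- 1 / e) > 0" using R by simp
  then have Rew: "0 < Re w" using Re by linarith
  have "2 * e * \<bar>Im w\<bar> \<le> 2 * e * b" using Im e by (intro mult_left_mono) auto
  also have "\<dots> = R powr (- 1 / e - 1) * (2 * t)" using e by (simp add: b_def)
  also have "\<dots> < R powr (- 1 / e - 1) * (2 * 2 powr (- 2 - e))"
    using R t by (intro mult_strict_left_mono) auto
  \<comment> \<open>The bound 2^(-2-e) is chosen to pay for Re w possibly being only half of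
    R^(-1/e).\<close>
  also have "2 * 2 powr (- 2 - e) = (1/2::real) powr (1 + e)"
  proof -
    have "2 * 2 powr (- 2 - e) = (2::real) powr (1 + (- 2 - e))" by (subst powr_add) simp
    also have "1 + (- 2 - e) = - (1 + e)" by simp
    also have "2 powr - (1 + e) = (1/2::real) powr (1 + e)"
      by (simp only: powr_minus_divide powr_divide powr_one_eq_one)
    finally show ?thesis .
  qed
  also have "R powr (- 1 / e - 1) * (1/2) powr (1 + e) = (R powr (- 1 / e) / 2) powr (1 + e)"
  proof -
    have "(- 1 / e) * (1 + e) = - 1 / e - 1" using e by (simp add: field_simps)
    then show ?thesis
      using R by (simp add: powr_divide powr_powr)
  qed
  also have "\<dots> \<le> Re w powr (1 + e)"
    using Re e R by (intro powr_mono2) auto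
  finally show "W powr - of_real (1 / e) \<in> cusp e"
    using Rew Im b1 unfolding w_def[symmetric] by (simp add: cusp_def)

  have W0: "W \<noteq> 0" using W by auto
  \<comment> \<open>The powers compose only if no branch is crossed: the imaginary part of Ln W / e
    is at most 1/8, far below pi, so \<open>Ln\<close> undoes \<open>exp\<close>.\<close>
  have "\<bar>Im (Ln W)\<bar> \<le> t / R" using abs_Im_Ln_le[of W] R by (simp add: R_def t_def)
  also have "\<dots> \<le> t" using R t by (simp add: divide_le_eq mult_le_cancel_left1)
  finally have "\<bar>Im (Ln W)\<bar> / e \<le> 1/8" using t e by (meson divide_right_mono less_imp_le order_trans)
  then have "\<bar>Im (- of_real (1 / e) * Ln W)\<bar> \<le> 1/8" using e by (simp add: abs_mult)
  then have "Ln (exp (- of_real (1 / e) * Ln W)) = - of_real (1 / e) * Ln W"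
    using pi_gt3 by (intro Ln_exp) linarith+
  then have "Ln w = - of_real (1 / e) * Ln W"
    using W0 by (simp add: w_def powr_def)
  moreover have "w \<noteq> 0" using Rew by auto
  ultimately show "(W powr - of_real (1 / e)) powr - of_real e = W"
    unfolding w_def[symmetric] using W0 e by (simp add: powr_def[of w])
qed

text \<open>On the disk - Ln (1 - z) has imaginary part below pi/2 in modulus and real part bounded
  below. The factor \<open>c\<close> makes the image thin, the shift by 2 moves it to Re >= 1, and z
  -> 1 goes to infinity, which the power -1/e turns into the tip of the cusp.\<close>

definition half_strip_map :: "real \<Rightarrow> complex \<Rightarrow> complex" where
  "half_strip_map c z = 2 - of_real c * Ln (1 - z)"

lemma half_strip_map_bounds:
  assumes "cmod z < 1" "0 < c" "c \<le> 1"
  shows "1 \<le> Re (half_strip_map c z)" "\<bar>Im (half_strip_map c z)\<bar> < 2 * c"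
proof -
  have z: "Re (1 - z) > 0" using assms complex_Re_le_cmod[of z] by simp
  have "cmod (1 - z) \<le> 2" using norm_triangle_ineq4[of 1 z] assms by simp
  moreover have z0: "1 - z \<noteq> 0" using z by auto
  ultimately have "ln (cmod (1 - z)) \<le> cmod (1 - z) - 1" "cmod (1 - z) - 1 \<le> 1"
    by (auto intro!: ln_le_minus_one)
  then have "Re (Ln (1 - z)) \<le> 1" using z0 by simp
  then have "c * Re (Ln (1 - z)) \<le> c * 1" using assms by (intro mult_left_mono) auto
  also have "c * 1 \<le> 1" using assms by simp
  finally have "c * Re (Ln (1 - z)) \<le> 1" .
  then show "1 \<le> Re (half_strip_map c z)" using assms by (simp add: half_strip_map_def)
  have "\<bar>Im (Ln (1 - z))\<bar> < pi/2" using z by (rule Re_Ln_pos_lt_imp)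
  then have "\<bar>Im (Ln (1 - z))\<bar> < 2" using pi_less_4 by simp
  then have "c * \<bar>Im (Ln (1 - z))\<bar> < c * 2" using assms by (intro mult_strict_left_mono) auto
  then show "\<bar>Im (half_strip_map c z)\<bar> < 2 * c" using assms by (simp add: half_strip_map_def abs_mult)
qed

lemma half_strip_map_inverse:
  assumes "cmod z < 1" "c \<noteq> 0"
  shows "1 - exp ((2 - half_strip_map c z) / of_real c) = z"
proof -
  have "z \<noteq> 1" using assms by auto
  then show ?thesis using assms by (simp add: half_strip_map_def)
qed

lemma half_strip_map_has_derivative:
  assumes "cmod z < 1"
  shows "(half_strip_map c has_field_derivative of_real c / (1 - z)) (at z)"
proof -
  have "Re (1 - z) > 0" using assms complex_Re_le_cmod[of z] by simp
  then have "1 - z \<notin> \<real>\<^sub>\<le>\<^sub>0" by (auto simp: complex_nonpos_Reals_iff)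
  then show ?thesis
    unfolding half_strip_map_def[abs_def]
    by (auto intro!: derivative_eq_intros simp: divide_inverse)
qed

text \<open>The imaginary part of \<open>half_strip_map c\<close> is below 2c, so the two upper
  bounds on \<open>c\<close> are half of those required by
  \<open>powr_inverse_mem_cusp\<close>.\<close>

locale spiral_param = spiral +
  fixes c :: real
  assumes c: "0 < c" "c \<le> e / 16" "c \<le> 2 powr (- 3 - e)"
begin

definition Z :: "complex \<Rightarrow> complex" where
  "Z z = half_strip_map c z powr - of_real (1 / e)"

lemma c_le_1: "c \<le> 1"
proof -
  have "2 powr (- 3 - e) \<le> 2 powr (0::real)" using e by (intro powr_mono) auto
  then show ?thesis using c by simp
qed

lemma Z_mem_cusp: "cmod z < 1 \<Longrightarrow> Z z \<in> cusp e"
  and Z_powr: "cmod z < 1 \<Longrightarrow> Z z powr - of_real e = half_strip_map c z"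
proof -
  assume z: "cmod z < 1"
  note W = half_strip_map_bounds[OF z c(1) c_le_1]
  have "2 * 2 powr (- 3 - e) = (2::real) powr (1 + (- 3 - e))" by (subst powr_add) simp
  then have W': "\<bar>Im (half_strip_map c z)\<bar> \<le> e / 8" "\<bar>Im (half_strip_map c z)\<bar> < 2 powr (- 2 - e)"
    using W(2) c by auto
  show "Z z \<in> cusp e" "Z z powr - of_real e = half_strip_map c z"
    unfolding Z_def using powr_inverse_mem_cusp[OF e W(1) W'] by blast+
qed

text \<open>An explicit left inverse of \<open>Z\<close>, from which continuity of the inverse
  parametrization is read off.\<close>

lemma Z_inverse: "cmod z < 1 \<Longrightarrow> 1 - exp ((2 - Z z powr - of_real e) / of_real c) = z"
  using half_strip_map_inverse[of z c] c by (simp add: Z_powr)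

lemma Re_Z_pos: "cmod z < 1 \<Longrightarrow> 0 < Re (Z z)"
  using Z_mem_cusp by (auto simp: cusp_def)

definition Z' :: "complex \<Rightarrow> complex" where
  "Z' z = - of_real (1 / e) * half_strip_map c z powr (- of_real (1 / e) - 1) * (of_real c / (1 - z))"

lemma Z_has_derivative:
  assumes "cmod z < 1"
  shows "(Z has_field_derivative Z' z) (at z)"
proof -
  have "half_strip_map c z \<notin> \<real>\<^sub>\<le>\<^sub>0"
    using half_strip_map_bounds[OF assms c(1) c_le_1] by (auto simp: complex_nonpos_Reals_iff)
  from DERIV_chain2[OF has_field_derivative_powr[OF this] half_strip_map_has_derivative[OF assms]]
  show ?thesis unfolding Z_def[abs_def] Z'_def .
qed

lemma Z'_nonzero:
  assumes "cmod z < 1"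
  shows "Z' z \<noteq> 0"
proof -
  have "half_strip_map c z \<noteq> 0"
    using half_strip_map_bounds[OF assms c(1) c_le_1] by auto
  moreover have "z \<noteq> 1" using assms by auto
  ultimately show ?thesis using c e by (simp add: Z'_def)
qed

text \<open>Solving 2 - c ln x = h^(-e) for x = 1 - z gives the witness; the condition h^(-e) >= 2
  is what makes x <= 1.\<close>

lemma Z_real:
  assumes h: "h > 0" "h powr - e \<ge> 2"
  obtains z where "cmod z < 1" "Z z = of_real h"
proof
  define x where "x = exp ((2 - h powr - e) / c)"
  have x: "0 < x" "x \<le> 1" using h c by (auto simp: x_def divide_nonpos_pos)
  show "cmod (of_real (1 - x)) < 1" using x by (simp only: norm_of_real)
  have "half_strip_map c (of_real (1 - x)) = of_real (h powr - e)"
    using x c by (simp add: half_strip_map_def Ln_of_real x_def)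
  then show "Z (of_real (1 - x)) = of_real h"
    using h e by (simp add: Z_def powr_of_real powr_powr flip: of_real_minus of_real_divide)
qed

text \<open>By \<open>Z_powr\<close> the exponent H is \<open>half_strip_map c\<close> on the disk.
  Writing it as a power of \<open>Z\<close> makes the factor \<open>Z'\<close> cancel in H' /
  Z'.\<close>

sublocale weierstrass Z "\<lambda>z. Z z powr - of_real e" "\<lambda>z. P (Z z)" "\<lambda>z. Q (Z z)" Z'
  "\<lambda>z. - of_real e * Z z powr (- of_real e - 1) * Z' z"
proof
  fix z :: complex assume "z \<in> ball 0 1"
  then have z: "cmod z < 1" by simp
  have "Z z \<notin> \<real>\<^sub>\<le>\<^sub>0" using Re_Z_pos[OF z] by (auto simp: complex_nonpos_Reals_iff)
  from DERIV_chain2[OF has_field_derivative_powr[OF this] Z_has_derivative[OF z]]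
  show "((\<lambda>z. Z z powr - of_real e) has_field_derivative
      - of_real e * Z z powr (- of_real e - 1) * Z' z) (at z)" .
  show "((\<lambda>z. P (Z z)) has_field_derivative sin (Z z powr - of_real e) * Z' z) (at z)"
    by (rule DERIV_chain2[OF P[OF Re_Z_pos[OF z]] Z_has_derivative[OF z]])
  show "((\<lambda>z. Q (Z z)) has_field_derivative - cos (Z z powr - of_real e) * Z' z) (at z)"
    by (rule DERIV_chain2[OF Q[OF Re_Z_pos[OF z]] Z_has_derivative[OF z]])
qed (auto simp: Z_has_derivative Z'_nonzero)

lemma surf_emb: "surf p = emb (Z (cplx p))"
  by (simp add: surf_eq emb_def)

text \<open>The surface is \<open>Z\<close> followed by \<open>emb\<close>; the inverse
  \<open>G\<close> undoes \<open>emb\<close> by its continuous inverse on the cusp and then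
  \<open>Z\<close> by the formula of \<open>Z_inverse\<close>.\<close>

lemma surf_homeomorphism: "\<exists>G. homeomorphism unit_disk (surf ` unit_disk) surf G"
proof -
  define \<psi> where "\<psi> = inv_into (cusp e) emb"
  define \<rho> :: "complex \<Rightarrow> real^2" where "\<rho> z = vector [Re z, Im z]" for z
  define G where "G q = \<rho> (1 - exp ((2 - \<psi> q powr - of_real e) / of_real c))" for q
  have sub: "surf ` unit_disk \<subseteq> emb ` cusp e"
    using Z_mem_cusp by (auto simp: surf_emb unit_disk_def)
  have G: "G (surf p) = p" if "p \<in> unit_disk" for p
  proof -
    have p: "cmod (cplx p) < 1" using that by (simp add: unit_disk_def)
    have "\<psi> (surf p) = Z (cplx p)"
      unfolding \<psi>_def surf_emb by (rule inv_into_f_f[OF emb_inj Z_mem_cusp[OF p]])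
    then show ?thesis
      using Z_inverse[OF p] by (simp add: G_def \<rho>_def cplx_def vec_eq_iff forall_2)
  qed
  have "continuous_on UNIV \<rho>"
  proof -
    have "continuous_on UNIV (\<lambda>z. \<rho> z $ j)" for j
      using exhaust_2[of j] by (elim disjE; simp add: \<rho>_def continuous_on_Im continuous_on_Re continuous_on_id)
    then have "continuous_on UNIV (\<lambda>z. \<chi> j. \<rho> z $ j)" by (rule continuous_on_vec_lambda)
    then show ?thesis by (simp add: vec_lambda_eta)
  qed
  moreover have "continuous_on (surf ` unit_disk) \<psi>"
    unfolding \<psi>_def by (rule continuous_on_subset[OF continuous_on_emb_inverse sub])
  moreover have "0 < Re (\<psi> q)" if "q \<in> surf ` unit_disk" for q
  proof -
    have "\<psi> q \<in> cusp e" unfolding \<psi>_def using sub that by (blast intro: inv_into_into)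
    then show ?thesis by (simp add: cusp_def)
  qed
  then have "0 \<le> Re (\<psi> q) \<and> \<psi> q \<noteq> 0" if "q \<in> surf ` unit_disk" for q
    using that by force
  ultimately have "continuous_on (surf ` unit_disk) G"
    unfolding G_def using c
    by (intro continuous_on_compose2[where f = "\<lambda>q. 1 - exp ((2 - \<psi> q powr - of_real e) / of_real c)"
          and g = \<rho> and t = UNIV]) (auto intro!: continuous_intros)
  moreover have "continuous_on unit_disk surf"
    using smooth_surf by (auto simp: smooth_on_def dest: spec[of _ 0])
  ultimately have "homeomorphism unit_disk (surf ` unit_disk) surf G"
    using G by (auto simp: homeomorphism_def image_image)
  then show ?thesis by blast
qed

lemma embedded_minimal_surf: "embedded_minimal_disk surf"
  using smooth_surf immersion_surf surf_homeomorphism mean_curvature_surf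
  by (auto simp: embedded_minimal_disk_def embedded_disk_def)

lemma surf_in_half_cylinder: "surf ` unit_disk \<subseteq> half_cylinder"
proof (rule image_subsetI)
  fix p assume "p \<in> unit_disk"
  then have z: "cmod (cplx p) < 1" by (simp add: unit_disk_def)
  note w = Z_mem_cusp[OF z]
  have "(Im (P (Z (cplx p))))\<^sup>2 \<le> (1/2)\<^sup>2" "(Im (Q (Z (cplx p))))\<^sup>2 \<le> (1/2)\<^sup>2"
    using abs_Im_P_le[OF w] abs_Im_Q_le[OF w] by (simp_all add: abs_le_square_iff[symmetric])
  then show "surf p \<in> half_cylinder"
    using Re_Z_pos[OF z] by (simp add: half_cylinder_def surf_eq power2_eq_square)
qed

section \<open>Growth of the curvature towards height zero\<close>

lemma curvature_surf:
  assumes "u \<in> unit_disk"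
  shows "second_ff_norm_sq surf u
    = 2 * e\<^sup>2 * cmod (Z (cplx u)) powr (- 2 * (1 + e)) / cosh (Im (Z (cplx u) powr - of_real e)) ^ 4"
proof -
  let ?w = "Z (cplx u)"
  have z: "cmod (cplx u) < 1" using assms by (simp add: unit_disk_def)
  have "cmod (?w powr (- of_real e - 1)) = cmod ?w powr (- e - 1)"
    by (subst norm_powr_real_powr') auto
  then have "(cmod (- of_real e * ?w powr (- of_real e - 1)))\<^sup>2 = e\<^sup>2 * (cmod ?w powr (- e - 1))\<^sup>2"
    by (simp add: norm_mult power_mult_distrib)
  also have "(cmod ?w powr (- e - 1))\<^sup>2 = cmod ?w powr (- 2 * (1 + e))"
  proof -
    have "- 2 * (1 + e) = (- e - 1) + (- e - 1)" by simp
    then show ?thesis by (simp only: powr_add power2_eq_square)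
  qed
  finally show ?thesis
    using second_ff_norm_sq_surf[OF assms] Z'_nonzero[OF z] by simp
qed

text \<open>The height Re w is at most |w|, the exponent is negative, and cosh is at least
  1.\<close>

lemma sup_curvature_surf_le:
  assumes "h > 0"
  shows "sup_curvature_above surf h \<le> ereal (2 * e\<^sup>2 * h powr (- 2 * (1 + e)))"
  unfolding sup_curvature_above_def
proof (rule SUP_least)
  fix u assume "u \<in> {u \<in> unit_disk. h \<le> surf u $ 3}"
  then have u: "u \<in> unit_disk" and "h \<le> Re (Z (cplx u))" by (simp_all add: surf_eq)
  then have "h \<le> cmod (Z (cplx u))" using complex_Re_le_cmod[of "Z (cplx u)"] by linarith
  then have "cmod (Z (cplx u)) powr (- 2 * (1 + e)) \<le> h powr (- 2 * (1 + e))"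
    using assms e by (intro powr_mono2') auto
  then have "2 * e\<^sup>2 * cmod (Z (cplx u)) powr (- 2 * (1 + e)) \<le> 2 * e\<^sup>2 * h powr (- 2 * (1 + e))"
    by (intro mult_left_mono) auto
  moreover have "x / cosh y ^ 4 \<le> x" if "x \<ge> 0" for x y :: real
    using that one_le_power[OF cosh_real_ge_1[of y], of 4] by (simp add: divide_le_eq mult_le_cancel_left1)
  ultimately show "ereal (second_ff_norm_sq surf u) \<le> ereal (2 * e\<^sup>2 * h powr (- 2 * (1 + e)))"
    unfolding curvature_surf[OF u] ereal_less_eq by (meson order_trans mult_nonneg_nonneg powr_ge_zero zero_le_power2 zero_le_numeral)
qed

text \<open>The upper bound is attained at the axis point of height \<open>h\<close>, where |w|
  equals the height and the power is real, so cosh contributes 1.\<close>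

lemma sup_curvature_surf_ge:
  assumes "h > 0" "h powr - e \<ge> 2"
  shows "ereal (2 * e\<^sup>2 * h powr (- 2 * (1 + e))) \<le> sup_curvature_above surf h"
proof -
  obtain z where z: "cmod z < 1" "Z z = of_real h" using Z_real[OF assms] .
  define u :: "real^2" where "u = vector [Re z, Im z]"
  have cu: "cplx u = z" by (simp add: u_def cplx_def complex_eq_iff)
  then have u: "u \<in> unit_disk" using z by (simp add: cplx_mem_ball[symmetric])
  have "of_real h powr - of_real e = (of_real (h powr - e) :: complex)"
    using assms by (simp add: powr_of_real flip: of_real_minus)
  then have "second_ff_norm_sq surf u = 2 * e\<^sup>2 * h powr (- 2 * (1 + e))"
    using assms by (simp add: curvature_surf[OF u] cu z)
  then show ?thesis
    unfolding sup_curvature_above_def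
    by (intro SUP_upper2[of u]) (use u cu z in \<open>auto simp: surf_eq\<close>)
qed

end

theorem corollary2:
  fixes \<epsilon> :: real
  assumes "\<epsilon> > 0"
  shows "\<exists>(F :: real^2 \<Rightarrow> real^3) (C :: real).
           embedded_minimal_disk F \<and> F ` unit_disk \<subseteq> half_cylinder \<and> C > 0 \<and>
           (\<forall>\<^sub>F h in at_right 0.
              ereal (1 / C * h powr (- 2 * (1 + \<epsilon>))) \<le> sup_curvature_above F h \<and>
              sup_curvature_above F h \<le> ereal (C * h powr (- 2 * (1 + \<epsilon>))))"
proof -
  have hol: "(\<lambda>w. sin (w powr - of_real \<epsilon>)) holomorphic_on {w. 0 < Re w}"
    "(\<lambda>w. - cos (w powr - of_real \<epsilon>)) holomorphic_on {w. 0 < Re w}"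
    by (auto intro!: holomorphic_intros simp: complex_nonpos_Reals_iff)
  have re: "of_real x powr - of_real \<epsilon> = (of_real (x powr - \<epsilon>) :: complex)" if "x > 0" for x
    using that by (simp add: powr_of_real flip: of_real_minus)
  obtain P where "\<And>w. 0 < Re w \<Longrightarrow> (P has_field_derivative sin (w powr - of_real \<epsilon>)) (at w)"
    "\<And>x. x > 0 \<Longrightarrow> Im (P (of_real x)) = 0"
    by (rule primitive_real_on_positive_reals[OF hol(1)]) (auto simp: re Im_sin_sinh)
  moreover obtain Q where "\<And>w. 0 < Re w \<Longrightarrow> (Q has_field_derivative - cos (w powr - of_real \<epsilon>)) (at w)"
    "\<And>x. x > 0 \<Longrightarrow> Im (Q (of_real x)) = 0"
    by (rule primitive_real_on_positive_reals[OF hol(2)]) (auto simp: re Im_cos_sinh)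
  ultimately interpret spiral_param \<epsilon> P Q "min (\<epsilon> / 16) (2 powr (- 3 - \<epsilon>))"
    using assms by unfold_locales auto
  \<comment> \<open>For k = 2 \<epsilon>^2 the supremum is exactly k times the power of h; k + 1/k
    dominates both k and 1/k.\<close>
  define C where "C = 2 * \<epsilon>\<^sup>2 + 1 / (2 * \<epsilon>\<^sup>2)"
  have "2 * \<epsilon>\<^sup>2 > 0" using assms by simp
  then have C: "C > 0" "2 * \<epsilon>\<^sup>2 \<le> C" "1 / C \<le> 2 * \<epsilon>\<^sup>2"
  proof -
    show "C > 0" "2 * \<epsilon>\<^sup>2 \<le> C" using \<open>2 * \<epsilon>\<^sup>2 > 0\<close> by (simp_all add: C_def add_pos_pos)
    have "1 \<le> 2 * \<epsilon>\<^sup>2 * C" using \<open>2 * \<epsilon>\<^sup>2 > 0\<close> by (simp add: C_def distrib_left)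
    then show "1 / C \<le> 2 * \<epsilon>\<^sup>2" using \<open>C > 0\<close> by (simp add: divide_le_eq)
  qed
  \<comment> \<open>At the threshold 2^(-1/\<epsilon>) the power h^(-\<epsilon>) equals 2; below it
    the axis point of height h is covered by the disk.\<close>
  have "eventually (\<lambda>h::real. 0 < h \<and> h < 2 powr (- 1 / \<epsilon>)) (at_right 0)"
    by (intro eventually_conj eventually_at_right_less order_tendstoD(2)[OF tendsto_ident_at]) auto
  then have "\<forall>\<^sub>F h in at_right 0.
      ereal (1 / C * h powr (- 2 * (1 + \<epsilon>))) \<le> sup_curvature_above surf h \<and>
      sup_curvature_above surf h \<le> ereal (C * h powr (- 2 * (1 + \<epsilon>)))"
  proof (rule eventually_mono)
    fix h :: real assume h: "0 < h \<and> h < 2 powr (- 1 / \<epsilon>)"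
    then have "(2 powr (- 1 / \<epsilon>)) powr - \<epsilon> \<le> h powr - \<epsilon>"
      using assms by (intro powr_mono2') auto
    then have "2 \<le> h powr - \<epsilon>" using assms by (simp add: powr_powr)
    note ge = sup_curvature_surf_ge[OF _ this] and le = sup_curvature_surf_le[of h]
    have "1 / C * h powr (- 2 * (1 + \<epsilon>)) \<le> 2 * \<epsilon>\<^sup>2 * h powr (- 2 * (1 + \<epsilon>))"
      "2 * \<epsilon>\<^sup>2 * h powr (- 2 * (1 + \<epsilon>)) \<le> C * h powr (- 2 * (1 + \<epsilon>))"
      by (intro mult_right_mono C; simp)+
    then show "ereal (1 / C * h powr (- 2 * (1 + \<epsilon>))) \<le> sup_curvature_above surf h \<and>
      sup_curvature_above surf h \<le> ereal (C * h powr (- 2 * (1 + \<epsilon>)))"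
      using ge le h by (meson ereal_less_eq(3) order_trans)
  qed
  then show ?thesis using embedded_minimal_surf surf_in_half_cylinder C(1) by blast
qed

end
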